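(* Let $\Psi:\mathsf{Map}\to\mathsf{Cat}$, $(\mathcal U,\mathfrak a)\mapsto\mathcal U$, be the forgetful functor from map-graded categories to small categories. (1) For every functor $\varphi:\mathcal V\to\mathcal U$ between small categories and every $\mathcal U$-graded category $\mathfrak a$, the morphism $(\varphi,\delta^{\varphi,\mathfrak a}):(\mathcal V,\mathfrak a^\varphi)\to(\mathcal U,\mathfrak a)$ is cartesian with respect to $\Psi$. (2) The category $\mathsf{Map}$ is fibered over $\mathsf{Cat}$ through $\Psi$.
   Context: Fix a commutative ring $k$. For a small category $\mathcal U$, a ($k$-linear) $\mathcal U$-graded category $\mathfrak a$ consists of a set $\mathfrak a_U$ for each object $U$; a $k$-module $\mathfrak a_u(A,A')$ for each $u:U\to U'$, $A\in\mathfrak a_U$, $A'\in\mathfrak a_{U'}$; compositions $\mathfrak a_{u'}(A',A'')\otimes_k\mathfrak a_u(A,A')\to\mathfrak a_{u'u}(A,A'')$ and identities $1_A\in\mathfrak a_{1_U}(A,A)$, associative and unital. A graded functor $(\varphi,F):(\mathcal V,\mathfrak b)\to(\mathcal U,\mathfrak a)$ is a functor $\varphi:\mathcal V\to\mathcal U$ with maps $\mathfrak b_V\to\mathfrak a_{\varphi(V)}$ and $k$-linear maps $\mathfrak b_v(B,B')\to\mathfrak a_{\varphi(v)}(F(B),F(B'))$ respecting compositions and identities. $\mathsf{Map}$ is the category of pairs $(\mathcal U,\mathfrak a)$ and graded functors. For $\varphi:\mathcal V\to\mathcal U$ and $\mathfrak a$ over $\mathcal U$, the $\mathcal V$-graded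 category $\mathfrak a^\varphi$ has $\mathfrak a^\varphi_V=\mathfrak a_{\varphi(V)}$, $\mathfrak a^\varphi_v(A,A')=\mathfrak a_{\varphi(v)}(A,A')$, with composition and identities from $\mathfrak a$; $\delta^{\varphi,\mathfrak a}$ is given by identity maps on object sets and on morphism modules. Given a functor $F:\mathcal A\to\mathcal X$, a morphism $a:B\to A$ in $\mathcal A$ with $F(a)=u:V\to U$ is cartesian (with respect to $F$) if for every $v:W\to V$ in $\mathcal X$ and every $C\in\mathcal A$ with $F(C)=W$, composition with $a$ is a bijection from the set of morphisms $C\to B$ over $v$ to the set of morphisms $C\to A$ over $uv$. $\mathcal A$ is fibered over $\mathcal X$ if for every $u:V\to U$ and every $A$ with $F(A)=U$ there is a cartesian morphism over $u$ with target $A$. *)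

theory Defs
  imports "HOL-Algebra.Module" "HOL-Library.FuncSet"
begin

text \<open>
  Every operation below is required to be \<open>undefined\<close> outside its mathematical domain, so that
  equality of records coincides with equality of the mathematical structures they describe. In
  particular the bijections in the notion of a cartesian morphism are bijections of the genuine sets
  of morphisms. The type variables play the role of a universe: \<^emph>\<open>small\<close> structures have their
  elements in the types \<open>'o\<close>, \<open>'m\<close>, \<open>'a\<close>, \<open>'x\<close>, while the categories of small structures live in
  types built from these.
\<close>

section \<open>Categories and functors\<close>

record ('o, 'm) cat =
  Obj :: "'o set"
  Arr :: "'m set"
  Dom :: "'m \<Rightarrow> 'o"
  Cod :: "'m \<Rightarrow> 'o"
  Ide :: "'o \<Rightarrow> 'm"
  Comp :: "'m \<Rightarrow> 'm \<Rightarrow> 'm"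

locale category =
  fixes C :: "('o, 'm) cat"
  assumes Dom: "Dom C \<in> Arr C \<rightarrow>\<^sub>E Obj C"
    and Cod: "Cod C \<in> Arr C \<rightarrow>\<^sub>E Obj C"
    and Ide: "Ide C \<in> Obj C \<rightarrow>\<^sub>E Arr C"
    and Dom_Ide: "X \<in> Obj C \<Longrightarrow> Dom C (Ide C X) = X"
    and Cod_Ide: "X \<in> Obj C \<Longrightarrow> Cod C (Ide C X) = X"
    and Comp_in_Arr: "\<lbrakk>f \<in> Arr C; g \<in> Arr C; Cod C f = Dom C g\<rbrakk> \<Longrightarrow> Comp C g f \<in> Arr C"
    and Dom_Comp: "\<lbrakk>f \<in> Arr C; g \<in> Arr C; Cod C f = Dom C g\<rbrakk> \<Longrightarrow> Dom C (Comp C g f) = Dom C f"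
    and Cod_Comp: "\<lbrakk>f \<in> Arr C; g \<in> Arr C; Cod C f = Dom C g\<rbrakk> \<Longrightarrow> Cod C (Comp C g f) = Cod C g"
    and Comp_undefined: "\<not> (f \<in> Arr C \<and> g \<in> Arr C \<and> Cod C f = Dom C g) \<Longrightarrow> Comp C g f = undefined"
    and Comp_Ide: "f \<in> Arr C \<Longrightarrow> Comp C f (Ide C (Dom C f)) = f"
    and Ide_Comp: "f \<in> Arr C \<Longrightarrow> Comp C (Ide C (Cod C f)) f = f"
    and Comp_assoc: "\<lbrakk>f \<in> Arr C; g \<in> Arr C; h \<in> Arr C; Cod C f = Dom C g; Cod C g = Dom C h\<rbrakk>
      \<Longrightarrow> Comp C h (Comp C g f) = Comp C (Comp C h g) f"

definition mk_cat ::
  "'o set \<Rightarrow> 'm set \<Rightarrow> ('m \<Rightarrow> 'o) \<Rightarrow> ('m \<Rightarrow> 'o) \<Rightarrow> ('o \<Rightarrow> 'm) \<Rightarrow> ('m \<Rightarrow> 'm \<Rightarrow> 'm) \<Rightarrow> ('o, 'm) cat"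
  where "mk_cat Ob Ar d c i m =
    \<lparr>Obj = Ob, Arr = Ar, Dom = restrict d Ar, Cod = restrict c Ar, Ide = restrict i Ob,
     Comp = (\<lambda>g f. if f \<in> Ar \<and> g \<in> Ar \<and> c f = d g then m g f else undefined)\<rparr>"

record ('o, 'm, 'p, 'q) fctr =
  Src :: "('o, 'm) cat"
  Trg :: "('p, 'q) cat"
  on_obj :: "'o \<Rightarrow> 'p"
  on_arr :: "'m \<Rightarrow> 'q"

locale is_functor =
  fixes F :: "('o, 'm, 'p, 'q) fctr"
  assumes category_Src: "category (Src F)"
    and category_Trg: "category (Trg F)"
    and on_obj: "on_obj F \<in> Obj (Src F) \<rightarrow>\<^sub>E Obj (Trg F)"
    and on_arr: "on_arr F \<in> Arr (Src F) \<rightarrow>\<^sub>E Arr (Trg F)"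
    and Dom_on_arr: "f \<in> Arr (Src F) \<Longrightarrow> Dom (Trg F) (on_arr F f) = on_obj F (Dom (Src F) f)"
    and Cod_on_arr: "f \<in> Arr (Src F) \<Longrightarrow> Cod (Trg F) (on_arr F f) = on_obj F (Cod (Src F) f)"
    and on_arr_Ide: "X \<in> Obj (Src F) \<Longrightarrow> on_arr F (Ide (Src F) X) = Ide (Trg F) (on_obj F X)"
    and on_arr_Comp: "\<lbrakk>f \<in> Arr (Src F); g \<in> Arr (Src F); Cod (Src F) f = Dom (Src F) g\<rbrakk>
      \<Longrightarrow> on_arr F (Comp (Src F) g f) = Comp (Trg F) (on_arr F g) (on_arr F f)"

definition id_fctr :: "('o, 'm) cat \<Rightarrow> ('o, 'm, 'o, 'm) fctr"
  where "id_fctr C = \<lparr>Src = C, Trg = C, on_obj = (\<lambda>X\<in>Obj C. X), on_arr = (\<lambda>f\<in>Arr C. f)\<rparr>"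

definition comp_fctr ::
  "('p, 'q, 'r, 's) fctr \<Rightarrow> ('o, 'm, 'p, 'q) fctr \<Rightarrow> ('o, 'm, 'r, 's) fctr"
  where "comp_fctr G F =
    \<lparr>Src = Src F, Trg = Trg G,
     on_obj = compose (Obj (Src F)) (on_obj G) (on_obj F),
     on_arr = compose (Arr (Src F)) (on_arr G) (on_arr F)\<rparr>"

definition CAT :: "(('o, 'm) cat, ('o, 'm, 'o, 'm) fctr) cat"
  where "CAT = mk_cat {C. category C} {F. is_functor F} Src Trg id_fctr comp_fctr"


section \<open>Cartesian morphisms and fibered categories\<close>

definition cartesian :: "('o, 'm, 'p, 'q) fctr \<Rightarrow> 'm \<Rightarrow> bool"
  where "cartesian F a \<longleftrightarrow>
    is_functor F \<and> a \<in> Arr (Src F) \<and>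
    (\<forall>v\<in>Arr (Trg F). \<forall>C\<in>Obj (Src F).
      Cod (Trg F) v = Dom (Trg F) (on_arr F a) \<and> on_obj F C = Dom (Trg F) v \<longrightarrow>
      bij_betw (\<lambda>c. Comp (Src F) a c)
        {c \<in> Arr (Src F). Dom (Src F) c = C \<and> Cod (Src F) c = Dom (Src F) a \<and> on_arr F c = v}
        {c \<in> Arr (Src F). Dom (Src F) c = C \<and> Cod (Src F) c = Cod (Src F) a \<and>
          on_arr F c = Comp (Trg F) (on_arr F a) v})"

text \<open>\<open>fibered F\<close> means that \<open>Src F\<close> is fibered over \<open>Trg F\<close> through \<open>F\<close>.\<close>

definition fibered :: "('o, 'm, 'p, 'q) fctr \<Rightarrow> bool"
  where "fibered F \<longleftrightarrow> is_functor F \<and>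
    (\<forall>u\<in>Arr (Trg F). \<forall>A\<in>Obj (Src F). on_obj F A = Cod (Trg F) u \<longrightarrow>
      (\<exists>a. cartesian F a \<and> on_arr F a = u \<and> Cod (Src F) a = A))"


section \<open>Linear and bilinear maps\<close>

definition linear_maps ::
  "('k, 'z) ring_scheme \<Rightarrow> ('k, 'x) module \<Rightarrow> ('k, 'y) module \<Rightarrow> ('x \<Rightarrow> 'y) set"
  where "linear_maps k M N = {f \<in> carrier M \<rightarrow>\<^sub>E carrier N.
    (\<forall>x\<in>carrier M. \<forall>y\<in>carrier M. f (x \<oplus>\<^bsub>M\<^esub> y) = f x \<oplus>\<^bsub>N\<^esub> f y) \<and>
    (\<forall>r\<in>carrier k. \<forall>x\<in>carrier M. f (r \<odot>\<^bsub>M\<^esub> x) = r \<odot>\<^bsub>N\<^esub> f x)}"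

text \<open>Bilinear maps stand for the linear maps out of the tensor product \<open>M \<otimes>\<^sub>k N\<close>.\<close>

definition bilinear_maps ::
  "('k, 'z) ring_scheme \<Rightarrow> ('k, 'x) module \<Rightarrow> ('k, 'y) module \<Rightarrow> ('k, 'w) module \<Rightarrow>
    ('x \<Rightarrow> 'y \<Rightarrow> 'w) set"
  where "bilinear_maps k M N P = {b \<in> carrier M \<rightarrow>\<^sub>E linear_maps k N P.
    \<forall>y\<in>carrier N. (\<lambda>x\<in>carrier M. b x y) \<in> linear_maps k M P}"

text \<open>
  The record underlying a module contains a ring multiplication and unit, which are irrelevant for
  modules; the predicate fixes these fields and the operations outside the carrier.
\<close>

definition standard_module :: "('k, 'z) ring_scheme \<Rightarrow> ('k, 'x) module \<Rightarrow> bool"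
  where "standard_module k M \<longleftrightarrow>
    module k M \<and> monoid.mult M = undefined \<and> monoid.one M = undefined \<and>
    ring.add M \<in> carrier M \<rightarrow>\<^sub>E (carrier M \<rightarrow>\<^sub>E carrier M) \<and>
    module.smult M \<in> carrier k \<rightarrow>\<^sub>E (carrier M \<rightarrow>\<^sub>E carrier M)"


section \<open>Graded categories\<close>

text \<open>
  \<open>GObj a U\<close> is the set \<open>a\<^sub>U\<close>, \<open>GHom a u A A'\<close> is the module \<open>a\<^sub>u(A, A')\<close>, \<open>GIde a U A\<close> is the
  identity \<open>1\<^sub>A\<close>, and \<open>GComp a u' u A A' A''\<close> is the composition of \<open>a\<^sub>u\<^sub>'(A', A'')\<close> with
  \<open>a\<^sub>u(A, A')\<close>.
\<close>

record ('k, 'o, 'm, 'a, 'x) graded =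
  GObj :: "'o \<Rightarrow> 'a set"
  GHom :: "'m \<Rightarrow> 'a \<Rightarrow> 'a \<Rightarrow> ('k, 'x) module"
  GIde :: "'o \<Rightarrow> 'a \<Rightarrow> 'x"
  GComp :: "'m \<Rightarrow> 'm \<Rightarrow> 'a \<Rightarrow> 'a \<Rightarrow> 'a \<Rightarrow> 'x \<Rightarrow> 'x \<Rightarrow> 'x"

definition hom_index ::
  "('o, 'm) cat \<Rightarrow> ('k, 'o, 'm, 'a, 'x) graded \<Rightarrow> 'm \<Rightarrow> 'a \<Rightarrow> 'a \<Rightarrow> bool"
  where "hom_index U a u A A' \<longleftrightarrow>
    u \<in> Arr U \<and> A \<in> GObj a (Dom U u) \<and> A' \<in> GObj a (Cod U u)"

definition comp_index ::
  "('o, 'm) cat \<Rightarrow> ('k, 'o, 'm, 'a, 'x) graded \<Rightarrow> 'm \<Rightarrow> 'm \<Rightarrow> 'a \<Rightarrow> 'a \<Rightarrow> 'a \<Rightarrow> bool"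
  where "comp_index U a u' u A A' A'' \<longleftrightarrow>
    hom_index U a u A A' \<and> hom_index U a u' A' A'' \<and> Cod U u = Dom U u'"

locale graded_category = category U
  for k :: "('k, 'z) ring_scheme" and U :: "('o, 'm) cat" +
  fixes a :: "('k, 'o, 'm, 'a, 'x) graded"
  assumes GObj_undefined: "X \<notin> Obj U \<Longrightarrow> GObj a X = undefined"
    and GHom: "hom_index U a u A A' \<Longrightarrow> standard_module k (GHom a u A A')"
    and GHom_undefined: "\<not> hom_index U a u A A' \<Longrightarrow> GHom a u A A' = undefined"
    and GIde: "\<lbrakk>X \<in> Obj U; A \<in> GObj a X\<rbrakk> \<Longrightarrow> GIde a X A \<in> carrier (GHom a (Ide U X) A A)"
    and GIde_undefined: "\<not> (X \<in> Obj U \<and> A \<in> GObj a X) \<Longrightarrow> GIde a X A = undefined"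
    and GComp: "comp_index U a u' u A A' A'' \<Longrightarrow>
      GComp a u' u A A' A'' \<in>
        bilinear_maps k (GHom a u' A' A'') (GHom a u A A') (GHom a (Comp U u' u) A A'')"
    and GComp_undefined: "\<not> comp_index U a u' u A A' A'' \<Longrightarrow> GComp a u' u A A' A'' = undefined"
    and GComp_GIde: "\<lbrakk>hom_index U a u A A'; f \<in> carrier (GHom a u A A')\<rbrakk> \<Longrightarrow>
      GComp a u (Ide U (Dom U u)) A A A' f (GIde a (Dom U u) A) = f"
    and GIde_GComp: "\<lbrakk>hom_index U a u A A'; f \<in> carrier (GHom a u A A')\<rbrakk> \<Longrightarrow>
      GComp a (Ide U (Cod U u)) u A A' A' (GIde a (Cod U u) A') f = f"
    and GComp_assoc: "\<lbrakk>comp_index U a u' u A A' A''; comp_index U a u'' u' A' A'' A''';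
        f \<in> carrier (GHom a u A A'); g \<in> carrier (GHom a u' A' A'');
        h \<in> carrier (GHom a u'' A'' A''')\<rbrakk> \<Longrightarrow>
      GComp a u'' (Comp U u' u) A A'' A''' h (GComp a u' u A A' A'' g f) =
      GComp a (Comp U u'' u') u A A' A''' (GComp a u'' u' A' A'' A''' h g) f"


section \<open>Graded functors and the category of map-graded categories\<close>

record ('k, 'o, 'm, 'a, 'x) gfctr =
  GSrc :: "('o, 'm) cat \<times> ('k, 'o, 'm, 'a, 'x) graded"
  GTrg :: "('o, 'm) cat \<times> ('k, 'o, 'm, 'a, 'x) graded"
  Base :: "('o, 'm, 'o, 'm) fctr"
  FObj :: "'o \<Rightarrow> 'a \<Rightarrow> 'a"
  FHom :: "'m \<Rightarrow> 'a \<Rightarrow> 'a \<Rightarrow> 'x \<Rightarrow> 'x"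

locale graded_functor = V: graded_category k V b + U: graded_category k U a + \<phi>: is_functor \<phi>
  for k :: "('k, 'z) ring_scheme"
    and V :: "('o, 'm) cat" and b :: "('k, 'o, 'm, 'a, 'x) graded"
    and U :: "('o, 'm) cat" and a :: "('k, 'o, 'm, 'a, 'x) graded"
    and \<phi> :: "('o, 'm, 'o, 'm) fctr" +
  fixes F :: "('k, 'o, 'm, 'a, 'x) gfctr"
  assumes GSrc: "GSrc F = (V, b)"
    and GTrg: "GTrg F = (U, a)"
    and Base: "Base F = \<phi>"
    and Src_Base: "Src \<phi> = V"
    and Trg_Base: "Trg \<phi> = U"
    and FObj: "X \<in> Obj V \<Longrightarrow> FObj F X \<in> GObj b X \<rightarrow>\<^sub>E GObj a (on_obj \<phi> X)"
    and FObj_undefined: "X \<notin> Obj V \<Longrightarrow> FObj F X = undefined"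
    and FHom: "hom_index V b v B B' \<Longrightarrow>
      FHom F v B B' \<in> linear_maps k (GHom b v B B')
        (GHom a (on_arr \<phi> v) (FObj F (Dom V v) B) (FObj F (Cod V v) B'))"
    and FHom_undefined: "\<not> hom_index V b v B B' \<Longrightarrow> FHom F v B B' = undefined"
    and FHom_GIde: "\<lbrakk>X \<in> Obj V; B \<in> GObj b X\<rbrakk> \<Longrightarrow>
      FHom F (Ide V X) B B (GIde b X B) = GIde a (on_obj \<phi> X) (FObj F X B)"
    and FHom_GComp: "\<lbrakk>comp_index V b v' v B B' B''; f \<in> carrier (GHom b v B B');
        g \<in> carrier (GHom b v' B' B'')\<rbrakk> \<Longrightarrow>
      FHom F (Comp V v' v) B B'' (GComp b v' v B B' B'' g f) =
      GComp a (on_arr \<phi> v') (on_arr \<phi> v)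
        (FObj F (Dom V v) B) (FObj F (Cod V v) B') (FObj F (Cod V v') B'')
        (FHom F v' B' B'' g) (FHom F v B B' f)"

definition id_gfctr ::
  "('o, 'm) cat \<times> ('k, 'o, 'm, 'a, 'x) graded \<Rightarrow> ('k, 'o, 'm, 'a, 'x) gfctr"
  where "id_gfctr = (\<lambda>(U, a).
    \<lparr>GSrc = (U, a), GTrg = (U, a), Base = id_fctr U,
     FObj = (\<lambda>X\<in>Obj U. \<lambda>A\<in>GObj a X. A),
     FHom = (\<lambda>u A A'. if hom_index U a u A A' then \<lambda>f\<in>carrier (GHom a u A A'). f else undefined)\<rparr>)"

definition comp_gfctr ::
  "('k, 'o, 'm, 'a, 'x) gfctr \<Rightarrow> ('k, 'o, 'm, 'a, 'x) gfctr \<Rightarrow> ('k, 'o, 'm, 'a, 'x) gfctr"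
  where "comp_gfctr G F = (let (W, c) = GSrc F; \<phi> = Base F in
    \<lparr>GSrc = GSrc F, GTrg = GTrg G, Base = comp_fctr (Base G) (Base F),
     FObj = (\<lambda>X\<in>Obj W. compose (GObj c X) (FObj G (on_obj \<phi> X)) (FObj F X)),
     FHom = (\<lambda>w C C'. if hom_index W c w C C'
       then compose (carrier (GHom c w C C'))
         (FHom G (on_arr \<phi> w) (FObj F (Dom W w) C) (FObj F (Cod W w) C')) (FHom F w C C')
       else undefined)\<rparr>)"

definition MAP :: "('k, 'z) ring_scheme \<Rightarrow>
    (('o, 'm) cat \<times> ('k, 'o, 'm, 'a, 'x) graded, ('k, 'o, 'm, 'a, 'x) gfctr) cat"
  where "MAP k = mk_cat {(U, a). graded_category k U a} {F. \<exists>V b U a \<phi>. graded_functor k V b U a \<phi> F}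
    GSrc GTrg id_gfctr comp_gfctr"

definition Psi :: "('k, 'z) ring_scheme \<Rightarrow>
    (('o, 'm) cat \<times> ('k, 'o, 'm, 'a, 'x) graded, ('k, 'o, 'm, 'a, 'x) gfctr,
     ('o, 'm) cat, ('o, 'm, 'o, 'm) fctr) fctr"
  where "Psi k = \<lparr>Src = MAP k, Trg = CAT,
    on_obj = restrict fst (Obj (MAP k)), on_arr = restrict Base (Arr (MAP k))\<rparr>"


section \<open>Pullback of a graded category along a functor\<close>

definition pullback :: "('o, 'm, 'o, 'm) fctr \<Rightarrow> ('k, 'o, 'm, 'a, 'x) graded \<Rightarrow>
    ('k, 'o, 'm, 'a, 'x) graded"
  where "pullback \<phi> a = (let V = Src \<phi>;
      ob = (\<lambda>X\<in>Obj V. GObj a (on_obj \<phi> X));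
      idx = (\<lambda>v A A'. v \<in> Arr V \<and> A \<in> ob (Dom V v) \<and> A' \<in> ob (Cod V v)) in
    \<lparr>GObj = ob,
     GHom = (\<lambda>v A A'. if idx v A A' then GHom a (on_arr \<phi> v) A A' else undefined),
     GIde = (\<lambda>X A. if X \<in> Obj V \<and> A \<in> ob X then GIde a (on_obj \<phi> X) A else undefined),
     GComp = (\<lambda>v' v A A' A''. if idx v A A' \<and> idx v' A' A'' \<and> Cod V v = Dom V v'
       then GComp a (on_arr \<phi> v') (on_arr \<phi> v) A A' A'' else undefined)\<rparr>)"

text \<open>\<open>delta \<phi> a\<close> is the graded functor \<open>(\<phi>, \<delta>) : (V, a\<^sup>\<phi>) \<rightarrow> (U, a)\<close>, including its base \<open>\<phi>\<close>.\<close>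

definition delta :: "('o, 'm, 'o, 'm) fctr \<Rightarrow> ('k, 'o, 'm, 'a, 'x) graded \<Rightarrow>
    ('k, 'o, 'm, 'a, 'x) gfctr"
  where "delta \<phi> a = (let V = Src \<phi>; b = pullback \<phi> a in
    \<lparr>GSrc = (V, b), GTrg = (Trg \<phi>, a), Base = \<phi>,
     FObj = (\<lambda>X\<in>Obj V. \<lambda>A\<in>GObj b X. A),
     FHom = (\<lambda>v A A'. if hom_index V b v A A' then \<lambda>f\<in>carrier (GHom b v A A'). f else undefined)\<rparr>)"

end

theory Submission
  imports Defs
begin

text \<open>
  A graded functor into a pullback and a graded functor into the category pulled back consist of the
  same data. Let \<open>\<phi> : V \<rightarrow> U\<close> and \<open>\<psi> : W \<rightarrow> V\<close> be functors, \<open>a\<close> a \<open>U\<close>-graded category and \<open>c\<close> a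
  \<open>W\<close>-graded one. A graded functor \<open>(W, c) \<rightarrow> (V, a\<^sup>\<phi>)\<close> over \<open>\<psi>\<close> is given by maps from \<open>c\<^sub>X\<close> to
  \<open>a\<^sup>\<phi>\<close> at \<open>\<psi>(X)\<close>, which is \<open>a\<close> at \<open>\<phi>(\<psi>(X))\<close>, and by linear maps into the modules of \<open>a\<^sup>\<phi>\<close> over
  \<open>\<psi>(w)\<close>, which are those of \<open>a\<close> over \<open>\<phi>(\<psi>(w))\<close>; the identities and compositions it has to respect
  are also those of \<open>a\<close>. So these data are exactly a graded functor \<open>(W, c) \<rightarrow> (U, a)\<close> over \<open>\<phi> \<psi>\<close>.

  Since \<open>\<delta>\<close> acts as the identity, composing with it leaves the maps untouched and only relabels
  the target and the base functor (\<open>comp_delta\<close>). Relabelling them back is inverse to this, and it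
  gives a graded functor into the pullback (\<open>graded_functor_lift\<close>). Hence composition with \<open>\<delta>\<close> is
  bijective, which is cartesianness (\<open>cartesian_delta\<close>), and \<open>\<delta>\<close> for \<open>\<phi>\<close> and \<open>a\<close> is the cartesian
  lift of \<open>\<phi>\<close> with target \<open>(U, a)\<close>.

  The notion of a cartesian morphism presupposes a functor between categories, so the category
  axioms for small categories and for map-graded categories, and functoriality of \<open>\<Psi>\<close>, are part
  of the claim. There the unit and associativity laws follow by extensionality
  (\<open>functor_eqI\<close>, \<open>graded_functor_eqI\<close>): as all operations are \<open>undefined\<close> off their domains, a
  graded functor is determined by its values on objects and homogeneous morphisms.
\<close>


section \<open>The category of small categories\<close>

context is_functor
begin

lemma on_obj_in: "X \<in> Obj (Src F) \<Longrightarrow> on_obj F X \<in> Obj (Trg F)"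
  using on_obj by auto

lemma on_arr_in: "f \<in> Arr (Src F) \<Longrightarrow> on_arr F f \<in> Arr (Trg F)"
  using on_arr by auto

end

context category
begin

lemma Dom_in: "f \<in> Arr C \<Longrightarrow> Dom C f \<in> Obj C"
  and Cod_in: "f \<in> Arr C \<Longrightarrow> Cod C f \<in> Obj C"
  and Ide_in: "X \<in> Obj C \<Longrightarrow> Ide C X \<in> Arr C"
  using Dom Cod Ide by auto

end

lemma functor_eqI:
  assumes F: "is_functor F" and G: "is_functor G"
    and "Src F = Src G" "Trg F = Trg G"
    and "\<And>X. X \<in> Obj (Src G) \<Longrightarrow> on_obj F X = on_obj G X"
    and "\<And>f. f \<in> Arr (Src G) \<Longrightarrow> on_arr F f = on_arr G f"
  shows "F = G"
proof -
  interpret F: is_functor F by fact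
  interpret G: is_functor G by fact
  have "on_obj F = on_obj G"
    using F.on_obj G.on_obj assms(3,5)
    by (intro extensionalityI[of _ "Obj (Src G)"]) (auto simp: PiE_def)
  moreover have "on_arr F = on_arr G"
    using F.on_arr G.on_arr assms(3,6)
    by (intro extensionalityI[of _ "Arr (Src G)"]) (auto simp: PiE_def)
  ultimately show ?thesis using assms(3,4) by (cases F; cases G) simp
qed

lemma is_functor_id:
  assumes "category C"
  shows "is_functor (id_fctr C)"
proof -
  interpret category C by fact
  show ?thesis
    by (rule is_functor.intro) (auto simp: id_fctr_def assms Dom_in Cod_in Ide_in Comp_in_Arr)
qed

lemma is_functor_comp:
  assumes F: "is_functor F" and G: "is_functor G" and FG: "Trg F = Src G"
  shows "is_functor (comp_fctr G F)"
proof -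
  interpret F: is_functor F by fact
  interpret G: is_functor G by fact
  interpret S: category "Src F" by (rule F.category_Src)
  show ?thesis
    using FG F.category_Src G.category_Trg F.on_obj_in F.on_arr_in G.on_obj_in G.on_arr_in
    by (intro is_functor.intro)
      (auto simp: comp_fctr_def compose_eq compose_def S.Dom_in S.Cod_in S.Ide_in S.Comp_in_Arr
        F.Dom_on_arr[unfolded FG] F.Cod_on_arr[unfolded FG] F.on_arr_Ide[unfolded FG]
        F.on_arr_Comp[unfolded FG] G.Dom_on_arr G.Cod_on_arr G.on_arr_Ide G.on_arr_Comp)
qed

lemma id_fctr_simps [simp]:
  "Src (id_fctr C) = C" "Trg (id_fctr C) = C"
  "X \<in> Obj C \<Longrightarrow> on_obj (id_fctr C) X = X"
  "f \<in> Arr C \<Longrightarrow> on_arr (id_fctr C) f = f"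
  by (simp_all add: id_fctr_def)

lemma comp_fctr_simps [simp]:
  "Src (comp_fctr G F) = Src F" "Trg (comp_fctr G F) = Trg G"
  "X \<in> Obj (Src F) \<Longrightarrow> on_obj (comp_fctr G F) X = on_obj G (on_obj F X)"
  "f \<in> Arr (Src F) \<Longrightarrow> on_arr (comp_fctr G F) f = on_arr G (on_arr F f)"
  by (simp_all add: comp_fctr_def compose_eq)

lemma comp_fctr_id:
  assumes "is_functor F"
  shows "comp_fctr F (id_fctr (Src F)) = F" "comp_fctr (id_fctr (Trg F)) F = F"
proof -
  interpret is_functor F by fact
  note [simp] = on_obj_in on_arr_in
  show "comp_fctr F (id_fctr (Src F)) = F"
    by (rule functor_eqI) (simp_all add: assms is_functor_comp is_functor_id category_Src)
  show "comp_fctr (id_fctr (Trg F)) F = F"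
    by (rule functor_eqI) (simp_all add: assms is_functor_comp is_functor_id category_Trg)
qed

lemma comp_fctr_assoc:
  assumes F: "is_functor F" and G: "is_functor G" and H: "is_functor H"
    and "Trg F = Src G" "Trg G = Src H"
  shows "comp_fctr H (comp_fctr G F) = comp_fctr (comp_fctr H G) F"
  by (rule functor_eqI)
    (use assms is_functor.on_obj_in[OF F] is_functor.on_arr_in[OF F]
      in \<open>simp_all add: is_functor_comp\<close>)

text \<open>
  The composition produced by \<open>mk_cat\<close> is already \<open>undefined\<close> on pairs that are not composable, so
  only the axioms on composable arrows remain to be checked.
\<close>

lemma category_mk_cat:
  assumes "\<And>f. f \<in> Ar \<Longrightarrow> d f \<in> Ob" "\<And>f. f \<in> Ar \<Longrightarrow> c f \<in> Ob"
    and "\<And>X. X \<in> Ob \<Longrightarrow> i X \<in> Ar" "\<And>X. X \<in> Ob \<Longrightarrow> d (i X) = X" "\<And>X. X \<in> Ob \<Longrightarrow> c (i X) = X"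
    and "\<And>f g. \<lbrakk>f \<in> Ar; g \<in> Ar; c f = d g\<rbrakk> \<Longrightarrow> m g f \<in> Ar"
    and "\<And>f g. \<lbrakk>f \<in> Ar; g \<in> Ar; c f = d g\<rbrakk> \<Longrightarrow> d (m g f) = d f"
    and "\<And>f g. \<lbrakk>f \<in> Ar; g \<in> Ar; c f = d g\<rbrakk> \<Longrightarrow> c (m g f) = c g"
    and "\<And>f. f \<in> Ar \<Longrightarrow> m f (i (d f)) = f" "\<And>f. f \<in> Ar \<Longrightarrow> m (i (c f)) f = f"
    and "\<And>f g h. \<lbrakk>f \<in> Ar; g \<in> Ar; h \<in> Ar; c f = d g; c g = d h\<rbrakk> \<Longrightarrow> m h (m g f) = m (m h g) f"
  shows "category (mk_cat Ob Ar d c i m)"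
  by unfold_locales (auto simp: mk_cat_def assms)

lemma category_CAT: "category CAT"
  unfolding CAT_def
  by (rule category_mk_cat)
    (simp_all add: is_functor.category_Src is_functor.category_Trg is_functor_id is_functor_comp
      comp_fctr_id comp_fctr_assoc)


section \<open>The category of map-graded categories\<close>

lemma linear_maps_D:
  assumes "f \<in> linear_maps k M N"
  shows "f \<in> extensional (carrier M)"
    and "x \<in> carrier M \<Longrightarrow> f x \<in> carrier N"
    and "\<lbrakk>x \<in> carrier M; y \<in> carrier M\<rbrakk> \<Longrightarrow> f (x \<oplus>\<^bsub>M\<^esub> y) = f x \<oplus>\<^bsub>N\<^esub> f y"
    and "\<lbrakk>r \<in> carrier k; x \<in> carrier M\<rbrakk> \<Longrightarrow> f (r \<odot>\<^bsub>M\<^esub> x) = r \<odot>\<^bsub>N\<^esub> f x"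
  using assms by (auto simp: linear_maps_def PiE_def)

lemma standard_module_closed:
  assumes "standard_module k M"
  shows "\<lbrakk>x \<in> carrier M; y \<in> carrier M\<rbrakk> \<Longrightarrow> x \<oplus>\<^bsub>M\<^esub> y \<in> carrier M"
    and "\<lbrakk>r \<in> carrier k; x \<in> carrier M\<rbrakk> \<Longrightarrow> r \<odot>\<^bsub>M\<^esub> x \<in> carrier M"
  using assms by (auto simp: standard_module_def PiE_iff)

lemma linear_maps_id:
  assumes "standard_module k M"
  shows "(\<lambda>x\<in>carrier M. x) \<in> linear_maps k M M"
  using standard_module_closed[OF assms] by (auto simp: linear_maps_def)

lemma linear_maps_compose:
  assumes M: "standard_module k M" and f: "f \<in> linear_maps k M N" and g: "g \<in> linear_maps k N P"
  shows "compose (carrier M) g f \<in> linear_maps k M P"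
  using standard_module_closed[OF M] linear_maps_D(2-)[OF f] linear_maps_D(2-)[OF g]
  by (auto simp: linear_maps_def compose_def)

context graded_category
begin

lemma hom_index_Ide: "\<lbrakk>X \<in> Obj U; A \<in> GObj a X\<rbrakk> \<Longrightarrow> hom_index U a (Ide U X) A A"
  by (simp add: hom_index_def Ide_in Dom_Ide Cod_Ide)

lemma comp_index_D:
  assumes "comp_index U a u' u A A' A''"
  shows "hom_index U a u A A'" "hom_index U a u' A' A''" "Cod U u = Dom U u'"
    and "u \<in> Arr U" "u' \<in> Arr U"
    and "hom_index U a (Comp U u' u) A A''"
  using assms by (auto simp: comp_index_def hom_index_def Comp_in_Arr Dom_Comp Cod_Comp)

lemma GComp_in:
  assumes "comp_index U a u' u A A' A''"
    and "f \<in> carrier (GHom a u A A')" "g \<in> carrier (GHom a u' A' A'')"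
  shows "GComp a u' u A A' A'' g f \<in> carrier (GHom a (Comp U u' u) A A'')"
  using GComp[OF assms(1)] assms(2,3) by (auto simp: bilinear_maps_def linear_maps_def)

end

text \<open>
  The composition in a graded category and the action of a graded functor are only meaningful on
  admissible indices. The following facts transport admissibility along a graded functor, which is
  what makes composites of graded functors defined where they should be.
\<close>

context graded_functor
begin

lemmas base_simps =
  \<phi>.Dom_on_arr[unfolded Src_Base Trg_Base] \<phi>.Cod_on_arr[unfolded Src_Base Trg_Base]
  \<phi>.on_arr_Ide[unfolded Src_Base Trg_Base] \<phi>.on_arr_Comp[unfolded Src_Base Trg_Base]
  \<phi>.on_obj_in[unfolded Src_Base Trg_Base] \<phi>.on_arr_in[unfolded Src_Base Trg_Base]

lemma FObj_in: "\<lbrakk>X \<in> Obj V; B \<in> GObj b X\<rbrakk> \<Longrightarrow> FObj F X B \<in> GObj a (on_obj \<phi> X)"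
  using FObj by auto

lemma hom_index_image:
  assumes "hom_index V b v B B'"
  shows "hom_index U a (on_arr \<phi> v) (FObj F (Dom V v) B) (FObj F (Cod V v) B')"
  using assms by (auto simp: hom_index_def base_simps FObj_in V.Dom_in V.Cod_in)

lemma comp_index_image:
  assumes "comp_index V b v' v B B' B''"
  shows "comp_index U a (on_arr \<phi> v') (on_arr \<phi> v)
    (FObj F (Dom V v) B) (FObj F (Cod V v) B') (FObj F (Cod V v') B'')"
  using assms hom_index_image[of v B B'] hom_index_image[of v' B' B'']
  by (auto simp: comp_index_def base_simps hom_index_def)

lemma FHom_in:
  assumes "hom_index V b v B B'" "f \<in> carrier (GHom b v B B')"
  shows "FHom F v B B' f \<in>
    carrier (GHom a (on_arr \<phi> v) (FObj F (Dom V v) B) (FObj F (Cod V v) B'))"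
  using linear_maps_D(2)[OF FHom] assms by blast

end

lemma graded_functor_eqI:
  assumes F: "graded_functor k V b U a \<phi> F" and G: "graded_functor k V b U a \<phi> G"
    and obj: "\<And>X B. \<lbrakk>X \<in> Obj V; B \<in> GObj b X\<rbrakk> \<Longrightarrow> FObj F X B = FObj G X B"
    and hom: "\<And>v B B' f. \<lbrakk>hom_index V b v B B'; f \<in> carrier (GHom b v B B')\<rbrakk>
      \<Longrightarrow> FHom F v B B' f = FHom G v B B' f"
  shows "F = G"
proof -
  interpret F: graded_functor k V b U a \<phi> F by fact
  interpret G: graded_functor k V b U a \<phi> G by fact
  have "FObj F X = FObj G X" for X
  proof (cases "X \<in> Obj V")
    case True
    then show ?thesis
      using F.FObj[of X] G.FObj[of X] obj[of X]
      by (intro extensionalityI[of _ "GObj b X"]) (auto simp: PiE_def)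
  qed (simp add: F.FObj_undefined G.FObj_undefined)
  moreover have "FHom F v B B' = FHom G v B B'" for v B B'
  proof (cases "hom_index V b v B B'")
    case True
    show ?thesis
      by (rule extensionalityI)
        (use linear_maps_D(1)[OF F.FHom[OF True]] linear_maps_D(1)[OF G.FHom[OF True]]
          hom[OF True] in auto)
  qed (simp add: F.FHom_undefined G.FHom_undefined)
  ultimately show ?thesis
    using F.GSrc F.GTrg F.Base G.GSrc G.GTrg G.Base
    by (cases F; cases G) (simp add: fun_eq_iff)
qed

lemma id_gfctr_simps [simp]:
  "GSrc (id_gfctr (U, a)) = (U, a)" "GTrg (id_gfctr (U, a)) = (U, a)"
  "Base (id_gfctr (U, a)) = id_fctr U"
  "\<lbrakk>X \<in> Obj U; A \<in> GObj a X\<rbrakk> \<Longrightarrow> FObj (id_gfctr (U, a)) X A = A"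
  "\<lbrakk>hom_index U a u A A'; f \<in> carrier (GHom a u A A')\<rbrakk> \<Longrightarrow> FHom (id_gfctr (U, a)) u A A' f = f"
  by (simp_all add: id_gfctr_def)

lemma comp_gfctr_simps:
  "GSrc (comp_gfctr G F) = GSrc F" "GTrg (comp_gfctr G F) = GTrg G"
  "Base (comp_gfctr G F) = comp_fctr (Base G) (Base F)"
  "\<lbrakk>GSrc F = (W, c); X \<in> Obj W; C \<in> GObj c X\<rbrakk> \<Longrightarrow>
    FObj (comp_gfctr G F) X C = FObj G (on_obj (Base F) X) (FObj F X C)"
  "\<lbrakk>GSrc F = (W, c); hom_index W c w C C'; f \<in> carrier (GHom c w C C')\<rbrakk> \<Longrightarrow>
    FHom (comp_gfctr G F) w C C' f =
      FHom G (on_arr (Base F) w) (FObj F (Dom W w) C) (FObj F (Cod W w) C') (FHom F w C C' f)"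
  by (simp_all add: comp_gfctr_def Let_def compose_eq split: prod.splits)

lemma graded_functor_id:
  assumes "graded_category k U a"
  shows "graded_functor k U a U a (id_fctr U) (id_gfctr (U, a))"
proof -
  interpret graded_category k U a by fact
  interpret \<phi>: is_functor "id_fctr U" by (rule is_functor_id) unfold_locales
  have idx: "u \<in> Arr U" "A \<in> GObj a (Dom U u)" "A' \<in> GObj a (Cod U u)"
    if "hom_index U a u A A'" for u A A'
    using that by (auto simp: hom_index_def)
  show ?thesis
  proof unfold_locales
    fix X assume "X \<in> Obj U"
    then show "FObj (id_gfctr (U, a)) X \<in> GObj a X \<rightarrow>\<^sub>E GObj a (on_obj (id_fctr U) X)"
      by (simp add: id_gfctr_def)
  next
    fix u A A' assume i: "hom_index U a u A A'"
    have "FHom (id_gfctr (U, a)) u A A' = (\<lambda>f\<in>carrier (GHom a u A A'). f)"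
      using i by (simp add: id_gfctr_def)
    then show "FHom (id_gfctr (U, a)) u A A' \<in> linear_maps k (GHom a u A A')
        (GHom a (on_arr (id_fctr U) u) (FObj (id_gfctr (U, a)) (Dom U u) A)
          (FObj (id_gfctr (U, a)) (Cod U u) A'))"
      using idx[OF i] by (simp add: linear_maps_id[OF GHom[OF i]] Dom_in Cod_in)
  next
    fix X B assume "X \<in> Obj U" "B \<in> GObj a X"
    then show "FHom (id_gfctr (U, a)) (Ide U X) B B (GIde a X B) =
        GIde a (on_obj (id_fctr U) X) (FObj (id_gfctr (U, a)) X B)"
      by (simp add: hom_index_Ide GIde)
  next
    fix u' u A A' A'' f g
    assume i: "comp_index U a u' u A A' A''"
      and f: "f \<in> carrier (GHom a u A A')" and g: "g \<in> carrier (GHom a u' A' A'')"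
    note j = comp_index_D[OF i]
    show "FHom (id_gfctr (U, a)) (Comp U u' u) A A'' (GComp a u' u A A' A'' g f) =
      GComp a (on_arr (id_fctr U) u') (on_arr (id_fctr U) u)
        (FObj (id_gfctr (U, a)) (Dom U u) A) (FObj (id_gfctr (U, a)) (Cod U u) A')
        (FObj (id_gfctr (U, a)) (Cod U u') A'')
        (FHom (id_gfctr (U, a)) u' A' A'' g) (FHom (id_gfctr (U, a)) u A A' f)"
      using idx[OF j(1)] idx[OF j(2)] j f g GComp_in[OF i f g]
      by (simp add: Dom_in Cod_in)
  qed (simp_all add: id_gfctr_def)
qed

lemma graded_functor_comp:
  assumes "graded_functor k W c V b \<psi> F" and "graded_functor k V b U a \<phi> G"
  shows "graded_functor k W c U a (comp_fctr \<phi> \<psi>) (comp_gfctr G F)"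
proof -
  interpret F: graded_functor k W c V b \<psi> F by fact
  interpret G: graded_functor k V b U a \<phi> G by fact
  interpret comp: is_functor "comp_fctr \<phi> \<psi>"
    by (rule is_functor_comp) (unfold_locales, simp add: F.Trg_Base G.Src_Base)
  note S = comp_gfctr_simps(4,5)[OF F.GSrc, unfolded F.Base]
  have idx: "w \<in> Arr W" "C \<in> GObj c (Dom W w)" "C' \<in> GObj c (Cod W w)"
    "Dom W w \<in> Obj W" "Cod W w \<in> Obj W"
    if "hom_index W c w C C'" for w C C'
    using that by (auto simp: hom_index_def F.V.Dom_in F.V.Cod_in)
  show ?thesis
  proof unfold_locales
    fix X assume X: "X \<in> Obj W"
    have "FObj (comp_gfctr G F) X = compose (GObj c X) (FObj G (on_obj \<psi> X)) (FObj F X)"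
      using X by (simp add: comp_gfctr_def F.GSrc F.Base)
    then show "FObj (comp_gfctr G F) X \<in> GObj c X \<rightarrow>\<^sub>E GObj a (on_obj (comp_fctr \<phi> \<psi>) X)"
      using X by (auto simp: compose_def F.Src_Base F.FObj_in F.base_simps G.FObj_in)
  next
    fix w C C' assume i: "hom_index W c w C C'"
    have "FHom (comp_gfctr G F) w C C' = compose (carrier (GHom c w C C'))
      (FHom G (on_arr \<psi> w) (FObj F (Dom W w) C) (FObj F (Cod W w) C')) (FHom F w C C')"
      using i by (simp add: comp_gfctr_def F.GSrc F.Base)
    also have "\<dots> \<in> linear_maps k (GHom c w C C') (GHom a (on_arr \<phi> (on_arr \<psi> w))
        (FObj G (on_obj \<psi> (Dom W w)) (FObj F (Dom W w) C))
        (FObj G (on_obj \<psi> (Cod W w)) (FObj F (Cod W w) C')))"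
      using linear_maps_compose[OF F.V.GHom[OF i] F.FHom[OF i] G.FHom[OF F.hom_index_image[OF i]]]
        idx[OF i]
      by (simp add: F.base_simps)
    finally show "FHom (comp_gfctr G F) w C C' \<in> linear_maps k (GHom c w C C')
        (GHom a (on_arr (comp_fctr \<phi> \<psi>) w) (FObj (comp_gfctr G F) (Dom W w) C)
          (FObj (comp_gfctr G F) (Cod W w) C'))"
      using idx[OF i] by (simp add: S F.Src_Base)
  next
    fix X C assume X: "X \<in> Obj W" and C: "C \<in> GObj c X"
    then show "FHom (comp_gfctr G F) (Ide W X) C C (GIde c X C) =
        GIde a (on_obj (comp_fctr \<phi> \<psi>) X) (FObj (comp_gfctr G F) X C)"
      by (simp add: S F.Src_Base F.V.hom_index_Ide F.V.GIde F.V.Dom_Ide F.V.Cod_Ide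
          F.FHom_GIde F.base_simps G.FHom_GIde F.FObj_in)
  next
    fix w' w C C' C'' f g
    assume i: "comp_index W c w' w C C' C''"
      and f: "f \<in> carrier (GHom c w C C')" and g: "g \<in> carrier (GHom c w' C' C'')"
    note j = F.V.comp_index_D[OF i]
    show "FHom (comp_gfctr G F) (Comp W w' w) C C'' (GComp c w' w C C' C'' g f) =
      GComp a (on_arr (comp_fctr \<phi> \<psi>) w') (on_arr (comp_fctr \<phi> \<psi>) w)
        (FObj (comp_gfctr G F) (Dom W w) C) (FObj (comp_gfctr G F) (Cod W w) C')
        (FObj (comp_gfctr G F) (Cod W w') C'')
        (FHom (comp_gfctr G F) w' C' C'' g) (FHom (comp_gfctr G F) w C C' f)"
      using idx[OF j(1)] idx[OF j(2)] j f g F.V.GComp_in[OF i f g]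
        F.FHom_in[OF j(1) f] F.FHom_in[OF j(2) g]
        G.FHom_GComp[OF F.comp_index_image[OF i] F.FHom_in[OF j(1) f]]
      by (simp add: S F.Src_Base F.V.Dom_Comp F.V.Cod_Comp F.FHom_GComp[OF i f g] F.base_simps)
  qed (use F.Src_Base G.Trg_Base in \<open>simp_all add: comp_gfctr_def F.GSrc G.GTrg F.Base G.Base\<close>)
qed

text \<open>
  A graded functor stores its source, target and base, so the existentially quantified parameters in
  the arrows of \<open>MAP\<close> can be recovered from it.
\<close>

lemma graded_functor_of_fields:
  assumes "graded_functor k V b U a \<phi> F"
  shows "graded_functor k (fst (GSrc F)) (snd (GSrc F)) (fst (GTrg F)) (snd (GTrg F)) (Base F) F"
  using assms graded_functor.GSrc[OF assms] graded_functor.GTrg[OF assms]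
    graded_functor.Base[OF assms]
  by simp

lemma Obj_MAP: "Obj (MAP k) = {(U, a). graded_category k U a}"
  and Arr_MAP: "Arr (MAP k) = {F. \<exists>V b U a \<phi>. graded_functor k V b U a \<phi> F}"
  and Dom_MAP: "F \<in> Arr (MAP k) \<Longrightarrow> Dom (MAP k) F = GSrc F"
  and Cod_MAP: "F \<in> Arr (MAP k) \<Longrightarrow> Cod (MAP k) F = GTrg F"
  and Ide_MAP: "X \<in> Obj (MAP k) \<Longrightarrow> Ide (MAP k) X = id_gfctr X"
  and Comp_MAP: "\<lbrakk>F \<in> Arr (MAP k); G \<in> Arr (MAP k); GTrg F = GSrc G\<rbrakk> \<Longrightarrow>
    Comp (MAP k) G F = comp_gfctr G F"
  by (simp_all add: MAP_def mk_cat_def)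

lemma graded_functor_in_Arr_MAP: "graded_functor k V b U a \<phi> F \<Longrightarrow> F \<in> Arr (MAP k)"
  unfolding Arr_MAP by blast

lemma Arr_MAP_E:
  assumes "F \<in> Arr (MAP k)" "GSrc F = (V, b)" "GTrg F = (U, a)"
  shows "graded_functor k V b U a (Base F) F"
proof -
  obtain V' b' U' a' \<phi> where "graded_functor k V' b' U' a' \<phi> F"
    using assms(1) by (auto simp: Arr_MAP)
  from graded_functor_of_fields[OF this] assms(2,3) show ?thesis by simp
qed

lemma comp_gfctr_id:
  assumes "graded_functor k V b U a \<phi> F"
  shows "comp_gfctr F (id_gfctr (V, b)) = F" "comp_gfctr (id_gfctr (U, a)) F = F"
proof -
  interpret graded_functor k V b U a \<phi> F by fact
  note S = comp_gfctr_simps(4,5)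
  have "comp_fctr \<phi> (id_fctr V) = \<phi>" "comp_fctr (id_fctr U) \<phi> = \<phi>"
    using comp_fctr_id[OF \<phi>.is_functor_axioms] by (simp_all add: Src_Base Trg_Base)
  then have R: "graded_functor k V b U a \<phi> (comp_gfctr F (id_gfctr (V, b)))"
    and L: "graded_functor k V b U a \<phi> (comp_gfctr (id_gfctr (U, a)) F)"
    using graded_functor_comp[OF graded_functor_id assms, OF V.graded_category_axioms]
      graded_functor_comp[OF assms graded_functor_id, OF U.graded_category_axioms]
    by simp_all
  show "comp_gfctr F (id_gfctr (V, b)) = F"
    by (rule graded_functor_eqI[OF R assms])
      (auto simp: S[of _ V b] hom_index_def V.Dom_in V.Cod_in)
  show "comp_gfctr (id_gfctr (U, a)) F = F"
    by (rule graded_functor_eqI[OF L assms])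
      (simp_all add: S[OF GSrc] Base FObj_in base_simps hom_index_image FHom_in)
qed

lemma comp_gfctr_assoc:
  assumes F: "graded_functor k W c V b \<psi> F" and G: "graded_functor k V b U a \<phi> G"
    and H: "graded_functor k U a T d \<theta> H"
  shows "comp_gfctr H (comp_gfctr G F) = comp_gfctr (comp_gfctr H G) F"
proof -
  interpret F: graded_functor k W c V b \<psi> F by fact
  interpret G: graded_functor k V b U a \<phi> G by fact
  interpret H: graded_functor k U a T d \<theta> H by fact
  have "comp_fctr \<theta> (comp_fctr \<phi> \<psi>) = comp_fctr (comp_fctr \<theta> \<phi>) \<psi>"
    by (rule comp_fctr_assoc)
      (simp_all add: F.\<phi>.is_functor_axioms G.\<phi>.is_functor_axioms H.\<phi>.is_functor_axioms
        F.Trg_Base G.Src_Base G.Trg_Base H.Src_Base)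
  then have L: "graded_functor k W c T d (comp_fctr (comp_fctr \<theta> \<phi>) \<psi>)
      (comp_gfctr H (comp_gfctr G F))"
    using graded_functor_comp[OF graded_functor_comp[OF F G] H] by simp
  note R = graded_functor_comp[OF F graded_functor_comp[OF G H]]
  have GF: "GSrc (comp_gfctr G F) = (W, c)"
    by (simp add: comp_gfctr_simps F.GSrc)
  note S = comp_gfctr_simps(4,5)[OF F.GSrc] comp_gfctr_simps(4,5)[OF G.GSrc]
    comp_gfctr_simps(4,5)[OF GF] comp_gfctr_simps(3)
  show ?thesis
  proof (rule graded_functor_eqI[OF L R])
    fix X C assume "X \<in> Obj W" "C \<in> GObj c X"
    then show "FObj (comp_gfctr H (comp_gfctr G F)) X C = FObj (comp_gfctr (comp_gfctr H G) F) X C"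
      by (simp add: S F.Base G.Base F.Src_Base F.FObj_in F.base_simps)
  next
    fix w C C' f assume i: "hom_index W c w C C'" and f: "f \<in> carrier (GHom c w C C')"
    have "w \<in> Arr W" "C \<in> GObj c (Dom W w)" "C' \<in> GObj c (Cod W w)"
      using i by (auto simp: hom_index_def)
    then show "FHom (comp_gfctr H (comp_gfctr G F)) w C C' f =
        FHom (comp_gfctr (comp_gfctr H G) F) w C C' f"
      using i f F.hom_index_image[OF i] F.FHom_in[OF i f]
      by (simp add: S F.Base G.Base F.Src_Base F.FObj_in F.base_simps F.V.Dom_in F.V.Cod_in)
  qed
qed

lemma category_MAP: "category (MAP k)"
  unfolding MAP_def
proof (rule category_mk_cat, goal_cases)
  case (1 F)
  then show ?case
    by (auto simp: graded_functor.GSrc graded_functor_def)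
next
  case (2 F)
  then show ?case by (auto simp: graded_functor.GTrg graded_functor_def)
next
  case (3 X)
  then show ?case using graded_functor_id by fastforce
next
  case (4 X)
  then show ?case by auto
next
  case (5 X)
  then show ?case by auto
next
  case (6 F G)
  then obtain V b U a \<phi> V' b' U' a' \<phi>' where
    "graded_functor k V b U a \<phi> F" "graded_functor k V' b' U' a' \<phi>' G" by blast
  with 6(3) show ?case
    using graded_functor_comp graded_functor.GSrc graded_functor.GTrg
    by (metis (mono_tags, lifting) Pair_inject mem_Collect_eq)
next
  case (7 F G)
  then show ?case by (simp add: comp_gfctr_simps)
next
  case (8 F G)
  then show ?case by (simp add: comp_gfctr_simps)
next
  case (9 F)
  then show ?case using comp_gfctr_id(1) graded_functor.GSrc by fastforce
next
  case (10 F)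
  then show ?case using comp_gfctr_id(2) graded_functor.GTrg by fastforce
next
  case (11 F G H)
  from 11(1-3) obtain V b U a \<phi> V' b' U' a' \<phi>' V'' b'' U'' a'' \<phi>'' where
    *: "graded_functor k V b U a \<phi> F" "graded_functor k V' b' U' a' \<phi>' G"
    "graded_functor k V'' b'' U'' a'' \<phi>'' H" by blast
  have "V' = U" "b' = a" "V'' = U'" "b'' = a'"
    using 11(4,5) *[THEN graded_functor.GSrc] *[THEN graded_functor.GTrg] by simp_all
  with * show ?case by (metis comp_gfctr_assoc)
qed


section \<open>The forgetful functor\<close>

lemma CAT_simps:
  "Obj CAT = {C. category C}" "Arr CAT = {F. is_functor F}"
  "is_functor F \<Longrightarrow> Dom CAT F = Src F" "is_functor F \<Longrightarrow> Cod CAT F = Trg F"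
  "category C \<Longrightarrow> Ide CAT C = id_fctr C"
  "\<lbrakk>is_functor F; is_functor G; Trg F = Src G\<rbrakk> \<Longrightarrow> Comp CAT G F = comp_fctr G F"
  by (simp_all add: CAT_def mk_cat_def)

lemma Psi_simps:
  "Src (Psi k) = MAP k" "Trg (Psi k) = CAT"
  "X \<in> Obj (MAP k) \<Longrightarrow> on_obj (Psi k) X = fst X"
  "F \<in> Arr (MAP k) \<Longrightarrow> on_arr (Psi k) F = Base F"
  by (simp_all add: Psi_def)

lemma Arr_MAP_base:
  assumes "F \<in> Arr (MAP k)"
  shows "is_functor (Base F)" "Src (Base F) = fst (GSrc F)" "Trg (Base F) = fst (GTrg F)"
proof -
  obtain V b U a where VU: "GSrc F = (V, b)" "GTrg F = (U, a)"
    by (cases "GSrc F"; cases "GTrg F")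
  interpret graded_functor k V b U a "Base F" F by (rule Arr_MAP_E[OF assms VU])
  show "is_functor (Base F)" "Src (Base F) = fst (GSrc F)" "Trg (Base F) = fst (GTrg F)"
    by (simp_all add: \<phi>.is_functor_axioms Src_Base Trg_Base VU)
qed

text \<open>
  Both sets of morphisms in the definition of a cartesian morphism have the form on the left-hand
  side; it is easier to compare them as sets of graded functors with prescribed data.
\<close>

lemma graded_functors_over:
  "{F \<in> Arr (MAP k). Dom (MAP k) F = (V, b) \<and> Cod (MAP k) F = (U, a) \<and> on_arr (Psi k) F = \<phi>} =
    {F. graded_functor k V b U a \<phi> F}"
proof (intro Set.set_eqI iffI; clarify)
  fix F assume "F \<in> Arr (MAP k)" "Dom (MAP k) F = (V, b)" "Cod (MAP k) F = (U, a)"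
  then show "graded_functor k V b U a (on_arr (Psi k) F) F"
    using Arr_MAP_E[of F k V b U a] by (simp add: Dom_MAP Cod_MAP Psi_simps)
next
  fix F assume F: "graded_functor k V b U a \<phi> F"
  then have "F \<in> Arr (MAP k)" by (rule graded_functor_in_Arr_MAP)
  then show "F \<in> Arr (MAP k) \<and> Dom (MAP k) F = (V, b) \<and> Cod (MAP k) F = (U, a) \<and>
      on_arr (Psi k) F = \<phi>"
    using F[THEN graded_functor.GSrc] F[THEN graded_functor.GTrg] F[THEN graded_functor.Base]
    by (simp add: Dom_MAP Cod_MAP Psi_simps)
qed

lemma is_functor_Psi: "is_functor (Psi k)"
proof -
  interpret category "MAP k" by (rule category_MAP)
  show ?thesis
  proof (rule is_functor.intro, unfold Psi_simps(1,2), goal_cases)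
    case 1
    show ?case by (rule category_MAP)
  next
    case 2
    show ?case by (rule category_CAT)
  next
    case 3
    show ?case by (auto simp: Psi_def Obj_MAP CAT_simps graded_category_def)
  next
    case 4
    show ?case by (auto simp: Psi_def CAT_simps Arr_MAP_base)
  next
    case (5 F)
    then show ?case
      using Dom_in[OF 5] by (simp add: Psi_simps Arr_MAP_base CAT_simps Dom_MAP)
  next
    case (6 F)
    then show ?case
      using Cod_in[OF 6] by (simp add: Psi_simps Arr_MAP_base CAT_simps Cod_MAP)
  next
    case (7 X)
    then show ?case
      using Ide_in[OF 7]
      by (auto simp: Psi_simps CAT_simps Ide_MAP Obj_MAP graded_category_def)
  next
    case (8 F G)
    then show ?case
      using Comp_in_Arr[OF 8]
      by (simp add: Psi_simps CAT_simps Comp_MAP Dom_MAP Cod_MAP Arr_MAP_base comp_gfctr_simps)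
  qed
qed


section \<open>Pullbacks are cartesian\<close>

locale graded_pullback = \<phi>: is_functor \<phi> + U: graded_category k "Trg \<phi>" a
  for k :: "('k, 'z) ring_scheme" and \<phi> :: "('o, 'm, 'o, 'm) fctr"
    and a :: "('k, 'o, 'm, 'a, 'x) graded"
begin

abbreviation V where "V \<equiv> Src \<phi>"
abbreviation b where "b \<equiv> pullback \<phi> a"

sublocale V: category V by (rule \<phi>.category_Src)

text \<open>
  An index is admissible for the pullback exactly if its image under \<open>\<phi>\<close> is admissible for \<open>a\<close>. By
  this, each axiom for the pullback is the axiom for \<open>a\<close> at the image index.
\<close>

lemma hom_index_pullback:
  "hom_index V b v A A' \<longleftrightarrow> v \<in> Arr V \<and> hom_index (Trg \<phi>) a (on_arr \<phi> v) A A'"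
  by (auto simp: hom_index_def pullback_def Let_def V.Dom_in V.Cod_in \<phi>.Dom_on_arr \<phi>.Cod_on_arr
      \<phi>.on_arr_in)

lemma comp_index_pullback:
  "comp_index V b v' v A A' A'' \<longleftrightarrow> v \<in> Arr V \<and> v' \<in> Arr V \<and> Cod V v = Dom V v' \<and>
    comp_index (Trg \<phi>) a (on_arr \<phi> v') (on_arr \<phi> v) A A' A''"
  by (auto simp: comp_index_def hom_index_pullback \<phi>.Dom_on_arr \<phi>.Cod_on_arr)

lemma pullback_simps:
  "X \<in> Obj V \<Longrightarrow> GObj b X = GObj a (on_obj \<phi> X)"
  "hom_index V b v A A' \<Longrightarrow> GHom b v A A' = GHom a (on_arr \<phi> v) A A'"
  "\<lbrakk>X \<in> Obj V; A \<in> GObj a (on_obj \<phi> X)\<rbrakk> \<Longrightarrow> GIde b X A = GIde a (on_obj \<phi> X) A"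
  "comp_index V b v' v A A' A'' \<Longrightarrow>
    GComp b v' v A A' A'' = GComp a (on_arr \<phi> v') (on_arr \<phi> v) A A' A''"
  by (auto simp: pullback_def Let_def hom_index_def comp_index_def)

lemma pullback_undefined:
  "X \<notin> Obj V \<Longrightarrow> GObj b X = undefined"
  "\<not> hom_index V b v A A' \<Longrightarrow> GHom b v A A' = undefined"
  "\<not> (X \<in> Obj V \<and> A \<in> GObj b X) \<Longrightarrow> GIde b X A = undefined"
  "\<not> comp_index V b v' v A A' A'' \<Longrightarrow> GComp b v' v A A' A'' = undefined"
  by (auto simp: pullback_def Let_def hom_index_def comp_index_def)

lemma hom_index_Ide_pullback:
  "\<lbrakk>X \<in> Obj V; A \<in> GObj a (on_obj \<phi> X)\<rbrakk> \<Longrightarrow> hom_index V b (Ide V X) A A"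
  by (simp add: hom_index_pullback V.Ide_in \<phi>.on_arr_Ide \<phi>.on_obj_in U.hom_index_Ide)

lemma comp_index_unit:
  assumes "hom_index V b v A A'"
  shows "comp_index V b v (Ide V (Dom V v)) A A A'"
    and "comp_index V b (Ide V (Cod V v)) v A A' A'"
  using assms
  by (auto simp: comp_index_def hom_index_def V.Ide_in V.Dom_Ide V.Cod_Ide V.Dom_in V.Cod_in)

sublocale V: graded_category k V b
proof unfold_locales
  fix v A A' assume i: "hom_index V b v A A'"
  then show "standard_module k (GHom b v A A')"
    by (simp add: pullback_simps U.GHom hom_index_pullback)
  fix f assume f: "f \<in> carrier (GHom b v A A')"
  have v: "v \<in> Arr V" and j: "hom_index (Trg \<phi>) a (on_arr \<phi> v) A A'"
    using i by (simp_all add: hom_index_pullback)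
  have A: "A \<in> GObj a (on_obj \<phi> (Dom V v))" "A' \<in> GObj a (on_obj \<phi> (Cod V v))"
    using j v by (auto simp: hom_index_def \<phi>.Dom_on_arr \<phi>.Cod_on_arr)
  show "GComp b v (Ide V (Dom V v)) A A A' f (GIde b (Dom V v) A) = f"
    using U.GComp_GIde[OF j] f v A i
    by (simp add: pullback_simps comp_index_unit[OF i] V.Dom_in \<phi>.on_arr_Ide \<phi>.Dom_on_arr)
  show "GComp b (Ide V (Cod V v)) v A A' A' (GIde b (Cod V v) A') f = f"
    using U.GIde_GComp[OF j] f v A i
    by (simp add: pullback_simps comp_index_unit[OF i] V.Cod_in \<phi>.on_arr_Ide \<phi>.Cod_on_arr)
next
  fix X A assume "X \<in> Obj V" "A \<in> GObj b X"
  then show "GIde b X A \<in> carrier (GHom b (Ide V X) A A)"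
    using U.GIde[of "on_obj \<phi> X" A]
    by (simp add: pullback_simps hom_index_Ide_pullback \<phi>.on_obj_in \<phi>.on_arr_Ide)
next
  fix v' v A A' A'' assume i: "comp_index V b v' v A A' A''"
  have j: "hom_index V b v A A'" "hom_index V b v' A' A''" "hom_index V b (Comp V v' v) A A''"
    using i by (auto simp: comp_index_def hom_index_def V.Comp_in_Arr V.Dom_Comp V.Cod_Comp)
  have k: "v \<in> Arr V" "v' \<in> Arr V" "Cod V v = Dom V v'"
    "comp_index (Trg \<phi>) a (on_arr \<phi> v') (on_arr \<phi> v) A A' A''"
    using i by (simp_all add: comp_index_pullback)
  show "GComp b v' v A A' A'' \<in>
      bilinear_maps k (GHom b v' A' A'') (GHom b v A A') (GHom b (Comp V v' v) A A'')"
    using U.GComp[OF k(4)] k by (simp add: pullback_simps i j \<phi>.on_arr_Comp)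
  fix v'' A''' f g h
  assume i': "comp_index V b v'' v' A' A'' A'''"
    and fgh: "f \<in> carrier (GHom b v A A')" "g \<in> carrier (GHom b v' A' A'')"
      "h \<in> carrier (GHom b v'' A'' A''')"
  have j': "hom_index V b v'' A'' A'''"
    using i' by (simp add: comp_index_def)
  have k': "v'' \<in> Arr V" "Cod V v' = Dom V v''"
    "comp_index (Trg \<phi>) a (on_arr \<phi> v'') (on_arr \<phi> v') A' A'' A'''"
    using i' by (simp_all add: comp_index_pullback)
  have l: "comp_index V b v'' (Comp V v' v) A A'' A'''"
    "comp_index V b (Comp V v'' v') v A A' A'''"
    using i i'
    by (auto simp: comp_index_def hom_index_def V.Comp_in_Arr V.Dom_Comp V.Cod_Comp)
  show "GComp b v'' (Comp V v' v) A A'' A''' h (GComp b v' v A A' A'' g f) =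
    GComp b (Comp V v'' v') v A A' A''' (GComp b v'' v' A' A'' A''' h g) f"
    using U.GComp_assoc[OF k(4) k'(3)] fgh k k'
    by (simp add: pullback_simps i i' j j' l \<phi>.on_arr_Comp)
qed (rule pullback_undefined; assumption)+

lemma delta_simps:
  "GSrc (delta \<phi> a) = (V, b)" "GTrg (delta \<phi> a) = (Trg \<phi>, a)" "Base (delta \<phi> a) = \<phi>"
  "\<lbrakk>X \<in> Obj V; A \<in> GObj b X\<rbrakk> \<Longrightarrow> FObj (delta \<phi> a) X A = A"
  "\<lbrakk>hom_index V b v A A'; f \<in> carrier (GHom b v A A')\<rbrakk> \<Longrightarrow> FHom (delta \<phi> a) v A A' f = f"
  by (simp_all add: delta_def Let_def)

text \<open>
  The action of \<open>\<delta>\<close> is evaluated while the modules are still written as those of the pullback, where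
  it is the identity; only then are they identified with the modules of \<open>a\<close>. Hence the simplifier is
  called twice in some steps.
\<close>

sublocale delta: graded_functor k V b "Trg \<phi>" a \<phi> "delta \<phi> a"
proof -
  have idx: "v \<in> Arr V" "A \<in> GObj b (Dom V v)" "A' \<in> GObj b (Cod V v)"
    if "hom_index V b v A A'" for v A A'
    using that by (auto simp: hom_index_def)
  show "graded_functor k V b (Trg \<phi>) a \<phi> (delta \<phi> a)"
  proof unfold_locales
    fix X assume "X \<in> Obj V"
    then show "FObj (delta \<phi> a) X \<in> GObj b X \<rightarrow>\<^sub>E GObj a (on_obj \<phi> X)"
      by (auto simp: delta_def Let_def pullback_simps)
  next
    fix v A A' assume i: "hom_index V b v A A'"
    have "FHom (delta \<phi> a) v A A' = (\<lambda>f\<in>carrier (GHom b v A A'). f)"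
      using i by (simp add: delta_def Let_def)
    then show "FHom (delta \<phi> a) v A A' \<in> linear_maps k (GHom b v A A')
        (GHom a (on_arr \<phi> v) (FObj (delta \<phi> a) (Dom V v) A) (FObj (delta \<phi> a) (Cod V v) A'))"
      using idx[OF i] linear_maps_id[OF V.GHom[OF i]]
      by (simp add: delta_simps V.Dom_in V.Cod_in) (simp add: pullback_simps(2)[OF i])
  next
    fix X A assume X: "X \<in> Obj V" and A: "A \<in> GObj b X"
    then show "FHom (delta \<phi> a) (Ide V X) A A (GIde b X A) =
        GIde a (on_obj \<phi> X) (FObj (delta \<phi> a) X A)"
      using V.GIde[OF X A] V.hom_index_Ide[OF X A]
      by (simp add: delta_simps) (simp add: pullback_simps)
  next
    fix v' v A A' A'' f g
    assume i: "comp_index V b v' v A A' A''"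
      and f: "f \<in> carrier (GHom b v A A')" and g: "g \<in> carrier (GHom b v' A' A'')"
    note j = V.comp_index_D[OF i]
    show "FHom (delta \<phi> a) (Comp V v' v) A A'' (GComp b v' v A A' A'' g f) =
      GComp a (on_arr \<phi> v') (on_arr \<phi> v)
        (FObj (delta \<phi> a) (Dom V v) A) (FObj (delta \<phi> a) (Cod V v) A')
        (FObj (delta \<phi> a) (Cod V v') A'')
        (FHom (delta \<phi> a) v' A' A'' g) (FHom (delta \<phi> a) v A A' f)"
      using idx[OF j(1)] idx[OF j(2)] j f g V.GComp_in[OF i f g]
      by (simp add: delta_simps V.Dom_in V.Cod_in) (simp add: pullback_simps(4)[OF i])
  qed (simp_all add: delta_def Let_def)
qed

text \<open>
  Because \<open>\<delta>\<close> acts as the identity on objects and morphisms, a composite with it differs from the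
  other factor only in the target and the base that it records.
\<close>

lemma comp_delta:
  assumes "graded_functor k W c V b \<psi> F"
  shows "comp_gfctr (delta \<phi> a) F = F\<lparr>GTrg := (Trg \<phi>, a), Base := comp_fctr \<phi> \<psi>\<rparr>"
proof -
  interpret F: graded_functor k W c V b \<psi> F by fact
  interpret D: graded_functor k W c "Trg \<phi>" a "comp_fctr \<phi> \<psi>" "comp_gfctr (delta \<phi> a) F"
    by (rule graded_functor_comp[OF assms delta.graded_functor_axioms])
  note S = comp_gfctr_simps(4,5)[OF F.GSrc, unfolded F.Base]
  have "FObj (comp_gfctr (delta \<phi> a) F) X = FObj F X" for X
  proof (cases "X \<in> Obj W")
    case True
    then show ?thesis
      using D.FObj[of X] F.FObj[of X]
      by (intro extensionalityI[of _ "GObj c X"])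
        (auto simp: PiE_def S delta_simps F.FObj_in F.base_simps)
  qed (simp add: D.FObj_undefined F.FObj_undefined)
  moreover have "FHom (comp_gfctr (delta \<phi> a) F) w C C' = FHom F w C C'" for w C C'
  proof (cases "hom_index W c w C C'")
    case True
    show ?thesis
      by (rule extensionalityI[OF linear_maps_D(1)[OF D.FHom[OF True]]
          linear_maps_D(1)[OF F.FHom[OF True]]])
        (simp add: S True delta_simps F.hom_index_image F.FHom_in)
  qed (simp add: D.FHom_undefined F.FHom_undefined)
  ultimately show ?thesis
    using D.GSrc D.GTrg D.Base F.GSrc
    by (intro gfctr.equality) (simp_all add: fun_eq_iff)
qed

text \<open>
  The existence half of the universal property: nothing has to be constructed, since the modules of
  \<open>a\<close> over \<open>\<phi>(\<psi>(w))\<close> are the modules of the pullback over \<open>\<psi>(w)\<close>. This works only because \<open>G\<close>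
  lies over a functor that factors through \<open>\<phi>\<close>; the factor \<open>\<psi>\<close> is the base of the lift.
\<close>

lemma graded_functor_lift:
  assumes G: "graded_functor k W c (Trg \<phi>) a (comp_fctr \<phi> \<psi>) G"
    and \<psi>: "is_functor \<psi>" "Src \<psi> = W" "Trg \<psi> = V"
  shows "graded_functor k W c V b \<psi> (G\<lparr>GTrg := (V, b), Base := \<psi>\<rparr>)"
    (is "graded_functor _ _ _ _ _ _ ?G")
proof -
  interpret G: graded_functor k W c "Trg \<phi>" a "comp_fctr \<phi> \<psi>" G by fact
  interpret \<psi>: is_functor \<psi> by fact
  note \<psi>_simps = \<psi>.Dom_on_arr[unfolded \<psi>(2,3)] \<psi>.Cod_on_arr[unfolded \<psi>(2,3)]
    \<psi>.on_arr_Ide[unfolded \<psi>(2,3)] \<psi>.on_arr_Comp[unfolded \<psi>(2,3)]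
    \<psi>.on_obj_in[unfolded \<psi>(2,3)] \<psi>.on_arr_in[unfolded \<psi>(2,3)]
  have hom: "hom_index V b (on_arr \<psi> w) (FObj G (Dom W w) C) (FObj G (Cod W w) C')"
    if "hom_index W c w C C'" for w C C'
    using G.hom_index_image[OF that] that
    by (simp add: hom_index_pullback hom_index_def[of W] \<psi>(2) \<psi>_simps)
  have comp: "comp_index V b (on_arr \<psi> w') (on_arr \<psi> w)
      (FObj G (Dom W w) C) (FObj G (Cod W w) C') (FObj G (Cod W w') C'')"
    if "comp_index W c w' w C C' C''" for w' w C C' C''
    using G.comp_index_image[OF that] G.V.comp_index_D[OF that]
    by (simp add: comp_index_pullback \<psi>(2) \<psi>_simps)
  show ?thesis
  proof unfold_locales
    fix X assume X: "X \<in> Obj W"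
    then show "FObj ?G X \<in> GObj c X \<rightarrow>\<^sub>E GObj b (on_obj \<psi> X)"
      using G.FObj[OF X] by (simp add: \<psi>(2) \<psi>_simps pullback_simps)
  next
    fix w C C' assume i: "hom_index W c w C C'"
    then show "FHom ?G w C C' \<in> linear_maps k (GHom c w C C')
        (GHom b (on_arr \<psi> w) (FObj ?G (Dom W w) C) (FObj ?G (Cod W w) C'))"
      using G.FHom[OF i] by (simp add: pullback_simps(2)[OF hom[OF i]] hom_index_def \<psi>(2))
  next
    fix X C assume X: "X \<in> Obj W" and C: "C \<in> GObj c X"
    then show "FHom ?G (Ide W X) C C (GIde c X C) = GIde b (on_obj \<psi> X) (FObj ?G X C)"
      using G.FHom_GIde[OF X C] G.FObj_in[OF X C]
      by (simp add: pullback_simps \<psi>(2) \<psi>_simps)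
  next
    fix w' w C C' C'' f g
    assume i: "comp_index W c w' w C C' C''"
      and fg: "f \<in> carrier (GHom c w C C')" "g \<in> carrier (GHom c w' C' C'')"
    show "FHom ?G (Comp W w' w) C C'' (GComp c w' w C C' C'' g f) =
      GComp b (on_arr \<psi> w') (on_arr \<psi> w)
        (FObj ?G (Dom W w) C) (FObj ?G (Cod W w) C') (FObj ?G (Cod W w') C'')
        (FHom ?G w' C' C'' g) (FHom ?G w C C' f)"
      using G.FHom_GComp[OF i fg] pullback_simps(4)[OF comp[OF i]] G.V.comp_index_D[OF i]
      by (simp add: \<psi>(2))
  qed (use G.FObj_undefined G.FHom_undefined in \<open>simp_all add: G.GSrc \<psi>(2,3)\<close>)
qed

text \<open>
  Composition with \<open>\<delta>\<close> replaces the target and base by those of \<open>(U, a)\<close> and \<open>\<phi> \<psi>\<close>, and the lift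
  replaces them by those of the pullback and \<open>\<psi>\<close>. On both sides target and base are prescribed, so
  these two replacements are mutually inverse.
\<close>

lemma cartesian_delta: "cartesian (Psi k) (delta \<phi> a)"
proof -
  have \<delta>: "delta \<phi> a \<in> Arr (MAP k)"
    by (rule graded_functor_in_Arr_MAP) (rule delta.graded_functor_axioms)
  have "bij_betw (\<lambda>F. Comp (MAP k) (delta \<phi> a) F)
      {F \<in> Arr (MAP k). Dom (MAP k) F = X \<and> Cod (MAP k) F = Dom (MAP k) (delta \<phi> a) \<and>
        on_arr (Psi k) F = \<psi>}
      {G \<in> Arr (MAP k). Dom (MAP k) G = X \<and> Cod (MAP k) G = Cod (MAP k) (delta \<phi> a) \<and>
        on_arr (Psi k) G = Comp CAT (on_arr (Psi k) (delta \<phi> a)) \<psi>}" (is "bij_betw _ ?A ?B")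
    if \<psi>: "is_functor \<psi>" "Trg \<psi> = V" and X: "fst X = Src \<psi>" for \<psi> X
  proof -
    obtain c where X: "X = (Src \<psi>, c)" using X by (cases X) simp
    have \<phi>\<psi>: "Comp CAT (on_arr (Psi k) (delta \<phi> a)) \<psi> = comp_fctr \<phi> \<psi>"
      using \<psi> by (simp add: Psi_simps \<delta> delta_simps CAT_simps \<phi>.is_functor_axioms)
    have A: "?A = {F. graded_functor k (Src \<psi>) c V b \<psi> F}"
      using graded_functors_over[of k "Src \<psi>" c V b \<psi>]
      by (simp add: X Dom_MAP Cod_MAP \<delta> delta_simps)
    have B: "?B = {G. graded_functor k (Src \<psi>) c (Trg \<phi>) a (comp_fctr \<phi> \<psi>) G}"
      unfolding \<phi>\<psi> using graded_functors_over[of k "Src \<psi>" c "Trg \<phi>" a "comp_fctr \<phi> \<psi>"]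
      by (simp add: X Dom_MAP Cod_MAP \<delta> delta_simps)
    have comp: "Comp (MAP k) (delta \<phi> a) F = comp_gfctr (delta \<phi> a) F"
      if "graded_functor k (Src \<psi>) c V b \<psi> F" for F
      using that by (intro Comp_MAP graded_functor_in_Arr_MAP[OF that] \<delta>)
        (simp add: delta_simps graded_functor.GTrg)
    note lift = graded_functor_lift[OF _ \<psi>(1) refl \<psi>(2)]
    show ?thesis
      unfolding A B
    proof (rule bij_betw_byWitness[where f' = "\<lambda>G. G\<lparr>GTrg := (V, b), Base := \<psi>\<rparr>"])
      show "\<forall>F\<in>{F. graded_functor k (Src \<psi>) c V b \<psi> F}.
          (Comp (MAP k) (delta \<phi> a) F)\<lparr>GTrg := (V, b), Base := \<psi>\<rparr> = F"
        by (auto simp: comp comp_delta graded_functor.GTrg[symmetric] graded_functor.Base[symmetric])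
      show "\<forall>G\<in>{G. graded_functor k (Src \<psi>) c (Trg \<phi>) a (comp_fctr \<phi> \<psi>) G}.
          Comp (MAP k) (delta \<phi> a) (G\<lparr>GTrg := (V, b), Base := \<psi>\<rparr>) = G"
        by (auto simp: comp[OF lift] comp_delta[OF lift]
          graded_functor.GTrg[symmetric] graded_functor.Base[symmetric])
      show "(\<lambda>F. Comp (MAP k) (delta \<phi> a) F) ` {F. graded_functor k (Src \<psi>) c V b \<psi> F}
          \<subseteq> {G. graded_functor k (Src \<psi>) c (Trg \<phi>) a (comp_fctr \<phi> \<psi>) G}"
        by (auto simp: comp intro: graded_functor_comp[OF _ delta.graded_functor_axioms])
      show "(\<lambda>G. G\<lparr>GTrg := (V, b), Base := \<psi>\<rparr>) `
          {G. graded_functor k (Src \<psi>) c (Trg \<phi>) a (comp_fctr \<phi> \<psi>) G}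
          \<subseteq> {F. graded_functor k (Src \<psi>) c V b \<psi> F}"
        using lift by auto
    qed
  qed
  then show ?thesis
    unfolding cartesian_def
    using is_functor_Psi \<delta>
    by (auto simp: Psi_simps CAT_simps delta_simps \<phi>.is_functor_axioms)
qed

end

theorem proposition2p25:
  fixes k :: "('k, 'z) ring_scheme"
  assumes "cring k"
  shows "(\<forall>(\<phi> :: ('o, 'm, 'o, 'm) fctr) V U (a :: ('k, 'o, 'm, 'a, 'x) graded).
        is_functor \<phi> \<and> Src \<phi> = V \<and> Trg \<phi> = U \<and> graded_category k U a \<longrightarrow>
        cartesian (Psi k) (delta \<phi> a)) \<and>
      fibered (Psi k ::
        (('o, 'm) cat \<times> ('k, 'o, 'm, 'a, 'x) graded, ('k, 'o, 'm, 'a, 'x) gfctr,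
         ('o, 'm) cat, ('o, 'm, 'o, 'm) fctr) fctr)"
proof -
  have pb: "graded_pullback k \<phi> a" if "is_functor \<phi>" "graded_category k (Trg \<phi>) a"
    for \<phi> :: "('o, 'm, 'o, 'm) fctr" and a :: "('k, 'o, 'm, 'a, 'x) graded"
    using that by (rule graded_pullback.intro)
  have "\<exists>\<alpha>. cartesian (Psi k) \<alpha> \<and> on_arr (Psi k) \<alpha> = \<phi> \<and> Cod (MAP k) \<alpha> = X"
    if \<phi>: "\<phi> \<in> Arr CAT" and X: "X \<in> Obj (MAP k)" "on_obj (Psi k) X = Cod CAT \<phi>"
    for \<phi> and X :: "('o, 'm) cat \<times> ('k, 'o, 'm, 'a, 'x) graded"
  proof -
    obtain a where a: "X = (Trg \<phi>, a)"
      using \<phi> X by (cases X) (auto simp: CAT_simps Psi_simps)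
    interpret graded_pullback k \<phi> a
      using \<phi> X(1) by (intro pb) (auto simp: a CAT_simps Obj_MAP)
    have "delta \<phi> a \<in> Arr (MAP k)"
      by (rule graded_functor_in_Arr_MAP) (rule delta.graded_functor_axioms)
    then show ?thesis
      using cartesian_delta
      by (intro exI[of _ "delta \<phi> a"]) (simp add: Psi_simps Cod_MAP delta_simps a)
  qed
  then show ?thesis
    using pb graded_pullback.cartesian_delta is_functor_Psi
    unfolding fibered_def Psi_simps by blast
qed

end
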